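(* Consider the bivariate location model with order restriction $\theta_1\le\theta_2$, squared error loss for estimating $\theta_2$, and, for a fixed $\beta\in\mathbb{R}$, the class $\mathcal{D}_{2,\beta}=\{\delta_\alpha:\alpha\in\mathbb{R}\}$ of estimators of $\theta_2$, with $c_{0,2}$, $f_Z$, $\psi_2$, $k_2$, $\alpha_2(\cdot)$ all as defined in the context. Put $\alpha_{2,0}=\alpha_2(0)$ and $\alpha_{2,\infty}=\lim_{\lambda\to\infty}\alpha_2(\lambda)\in[-\infty,\infty]$. (a) Suppose that $\psi_2$ is increasing on $(-\infty,c_{0,2}-\beta)$ and that one of the following holds: (i) $f_Z$ is log-concave on $(-\infty,c_{0,2}-\beta)$ and, for every $\lambda\ge 0$, $z\mapsto k_2(z,\lambda)$ is increasing on $(-\infty,0)$; or (ii) $f_Z$ is log-convex on $(-\infty,c_{0,2}-\beta)$ and, for every $\lambda\ge 0$, $z\mapsto k_2(z,\lambda)$ is decreasing on $(-\infty,0)$. Then the estimators that are admissible within the class $\mathcal{D}_{2,\beta}$ are exactly those $\delta_\alpha$ with $\alpha\in\mathbb{R}$, $\alpha_{2,0}\le\alpha\le\alpha_{2,\infty}$. Moreover, if $-\infty<a<b\le\alpha_{2,0}$ or $\alpha_{2,\infty}\le b<a<\infty$, then $\delta_b$ dominates $\delta_a$, i.e. $R_2(\underline\theta,\delta_b)\le R_2(\underline\theta,\delta_a)$ for all $\underline\theta\in\Theta_0$. (b) Suppose that $\psi_2$ is decreasing on $(-\infty,c_{0,2}-\beta)$ and that one of the following holds: (i) $f_Z$ is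 log-concave on $(-\infty,c_{0,2}-\beta)$ and, for every $\lambda\ge 0$, $z\mapsto k_2(z,\lambda)$ is decreasing on $(-\infty,0)$; or (ii) $f_Z$ is log-convex on $(-\infty,c_{0,2}-\beta)$ and, for every $\lambda\ge 0$, $z\mapsto k_2(z,\lambda)$ is increasing on $(-\infty,0)$. Then the estimators that are admissible within the class $\mathcal{D}_{2,\beta}$ are exactly those $\delta_\alpha$ with $\alpha\in\mathbb{R}$, $\alpha_{2,\infty}\le\alpha\le\alpha_{2,0}$. Moreover, if $-\infty<a<b\le\alpha_{2,\infty}$ or $\alpha_{2,0}\le b<a<\infty$, then $\delta_b$ dominates $\delta_a$, i.e. $R_2(\underline\theta,\delta_b)\le R_2(\underline\theta,\delta_a)$ for all $\underline\theta\in\Theta_0$.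
   Context: Model: $f$ is a fixed Lebesgue probability density on $\mathbb{R}^2$ and $\underline X=(X_1,X_2)$ has density $f(x_1-\theta_1,x_2-\theta_2)$ with unknown $\underline\theta=(\theta_1,\theta_2)\in\Theta_0=\{(t_1,t_2)\in\mathbb{R}^2:t_1\le t_2\}$. Put $\lambda=\theta_2-\theta_1\ge0$, $Z_i=X_i-\theta_i$ ($i=1,2$), $Z=Z_2-Z_1$; the pair $(Z_1,Z_2)$ has density $f$ whatever $\underline\theta$ is. It is assumed that $E[Z_1^2],E[Z_2^2]<\infty$. $c_{0,2}=E[Z_2]$ (so $X_2-c_{0,2}$ is the best location equivariant estimator of $\theta_2$). $\beta\in\mathbb{R}$ is a fixed constant. Estimators: for $\alpha\in\mathbb{R}$, $$\delta_\alpha(\underline X)=\begin{cases}X_2-c_{0,2},&\text{if }X_1-\beta\le X_2-c_{0,2},\\ \alpha(X_1-\beta)+(1-\alpha)(X_2-c_{0,2}),&\text{if }X_1-\beta>X_2-c_{0,2},\end{cases}$$ and $\mathcal{D}_{2,\beta}=\{\delta_\alpha:\alpha\in\mathbb{R}\}$. Risk: $R_2(\underline\theta,\delta)=E_{\underline\theta}[(\delta(\underline X)-\theta_2)^2]$, $\underline\theta\in\Theta_0$. An estimator $\delta\in\mathcal{D}_{2,\beta}$ is admissible within $\mathcal{D}_{2,\beta}$ if there is no $\delta'\in\mathcal{D}_{2,\beta}$ with $R_2(\underline\theta,\delta')\le R_2(\underline\theta,\delta)$ for all $\underline\theta\in\Theta_0$ and strict inequality for some $\underline\theta\in\Theta_0$.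 Functions: $f_Z(z)=\int_{-\infty}^\infty f(s,s+z)\,ds$ is the density of $Z$; $\psi_2(z)=E[Z_2\mid Z=z]=\int_{-\infty}^\infty s f(s-z,s)\,ds\,/\,\int_{-\infty}^\infty f(s-z,s)\,ds$; it is assumed that $0<f_Z(z)<\infty$ and that $\psi_2(z)$ is well defined (finite) for all $z\in(-\infty,c_{0,2}-\beta)$. For $z<0$, $\lambda\ge0$, $$k_2(z,\lambda)=\frac{\psi_2(z+c_{0,2}-\beta-\lambda)-c_{0,2}}{z}.$$ For $\lambda\ge0$, with $I_A$ the indicator of $A$, $$\alpha_2(\lambda)=\frac{E[(Z_2-c_{0,2})(Z+\lambda+\beta-c_{0,2})I_{(-\infty,c_{0,2}-\beta-\lambda)}(Z)]}{E[(Z+\lambda+\beta-c_{0,2})^2I_{(-\infty,c_{0,2}-\beta-\lambda)}(Z)]}.$$ "Increasing" means non-decreasing and "decreasing" means non-increasing. *)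

theory Defs
  imports "HOL-Probability.Probability"
begin

text \<open>
  Conventions: \<open>f\<close> is a density on the plane, \<open>z = (z\<^sub>1, z\<^sub>2)\<close> stands for the value of
  \<open>(Z\<^sub>1, Z\<^sub>2)\<close>, \<open>x = (x\<^sub>1, x\<^sub>2)\<close> for the observation and \<open>\<theta> = (\<theta>\<^sub>1, \<theta>\<^sub>2)\<close> for the parameter.
  ``Increasing'' and ``decreasing'' are in the weak sense, i.e. \<open>mono_on\<close> and \<open>antimono_on\<close>.
\<close>

definition noise_dist :: "(real \<times> real \<Rightarrow> real) \<Rightarrow> (real \<times> real) measure" where
  "noise_dist f = density lborel (\<lambda>z. ennreal (f z))"

definition obs_dist :: "(real \<times> real \<Rightarrow> real) \<Rightarrow> real \<times> real \<Rightarrow> (real \<times> real) measure" where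
  "obs_dist f \<theta> = density lborel (\<lambda>x. ennreal (f (fst x - fst \<theta>, snd x - snd \<theta>)))"

definition Theta0 :: "(real \<times> real) set" where
  "Theta0 = {\<theta>. fst \<theta> \<le> snd \<theta>}"

definition c02 :: "(real \<times> real \<Rightarrow> real) \<Rightarrow> real" where
  "c02 f = (\<integral>z. snd z \<partial>noise_dist f)"

definition delta_est :: "(real \<times> real \<Rightarrow> real) \<Rightarrow> real \<Rightarrow> real \<Rightarrow> real \<times> real \<Rightarrow> real" where
  "delta_est f \<beta> \<alpha> x =
     (if fst x - \<beta> \<le> snd x - c02 f then snd x - c02 f
      else \<alpha> * (fst x - \<beta>) + (1 - \<alpha>) * (snd x - c02 f))"

definition D2 :: "(real \<times> real \<Rightarrow> real) \<Rightarrow> real \<Rightarrow> (real \<times> real \<Rightarrow> real) set" where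
  "D2 f \<beta> = {delta_est f \<beta> \<alpha> | \<alpha>. True}"

definition R2 :: "(real \<times> real \<Rightarrow> real) \<Rightarrow> real \<times> real \<Rightarrow> (real \<times> real \<Rightarrow> real) \<Rightarrow> real" where
  "R2 f \<theta> \<delta> = (\<integral>x. (\<delta> x - snd \<theta>)\<^sup>2 \<partial>obs_dist f \<theta>)"

definition admissible_in ::
  "(real \<times> real \<Rightarrow> real) \<Rightarrow> (real \<times> real \<Rightarrow> real) set \<Rightarrow> (real \<times> real \<Rightarrow> real) \<Rightarrow> bool" where
  "admissible_in f D \<delta> \<longleftrightarrow> \<delta> \<in> D \<and>
     \<not> (\<exists>\<delta>'\<in>D. (\<forall>\<theta>\<in>Theta0. R2 f \<theta> \<delta>' \<le> R2 f \<theta> \<delta>) \<and> (\<exists>\<theta>\<in>Theta0. R2 f \<theta> \<delta>' < R2 f \<theta> \<delta>))"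

text \<open>Domination is meant in the weak sense: no strict inequality is required.\<close>

definition dominates ::
  "(real \<times> real \<Rightarrow> real) \<Rightarrow> (real \<times> real \<Rightarrow> real) \<Rightarrow> (real \<times> real \<Rightarrow> real) \<Rightarrow> bool" where
  "dominates f \<delta>' \<delta> \<longleftrightarrow> (\<forall>\<theta>\<in>Theta0. R2 f \<theta> \<delta>' \<le> R2 f \<theta> \<delta>)"

definition fZ :: "(real \<times> real \<Rightarrow> real) \<Rightarrow> real \<Rightarrow> real" where
  "fZ f z = (\<integral>s. f (s, s + z) \<partial>lborel)"

definition psi2 :: "(real \<times> real \<Rightarrow> real) \<Rightarrow> real \<Rightarrow> real" where
  "psi2 f z = (\<integral>s. s * f (s - z, s) \<partial>lborel) / (\<integral>s. f (s - z, s) \<partial>lborel)"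

definition k2 :: "(real \<times> real \<Rightarrow> real) \<Rightarrow> real \<Rightarrow> real \<Rightarrow> real \<Rightarrow> real" where
  "k2 f \<beta> z l = (psi2 f (z + c02 f - \<beta> - l) - c02 f) / z"

definition alpha2 :: "(real \<times> real \<Rightarrow> real) \<Rightarrow> real \<Rightarrow> real \<Rightarrow> real" where
  "alpha2 f \<beta> l =
     (\<integral>z. (snd z - c02 f) * ((snd z - fst z) + l + \<beta> - c02 f)
            * indicator {..<c02 f - \<beta> - l} (snd z - fst z) \<partial>noise_dist f) /
     (\<integral>z. ((snd z - fst z) + l + \<beta> - c02 f)\<^sup>2
            * indicator {..<c02 f - \<beta> - l} (snd z - fst z) \<partial>noise_dist f)"

text \<open>
  \<open>Lim\<close> is a definite description, so \<open>alpha2_inf\<close> only carries information together with the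
  convergence of \<open>alpha2\<close>.
\<close>

definition alpha2_inf :: "(real \<times> real \<Rightarrow> real) \<Rightarrow> real \<Rightarrow> ereal" where
  "alpha2_inf f \<beta> = Lim at_top (\<lambda>l. ereal (alpha2 f \<beta> l))"

definition log_concave_on :: "real set \<Rightarrow> (real \<Rightarrow> real) \<Rightarrow> bool" where
  "log_concave_on S g \<longleftrightarrow> (\<forall>x\<in>S. 0 < g x) \<and> concave_on S (\<lambda>x. ln (g x))"

definition log_convex_on :: "real set \<Rightarrow> (real \<Rightarrow> real) \<Rightarrow> bool" where
  "log_convex_on S g \<longleftrightarrow> (\<forall>x\<in>S. 0 < g x) \<and> convex_on S (\<lambda>x. ln (g x))"

end

theory Submission
  imports Defs
begin

text \<open>
  The risk of \<open>\<delta>\<^sub>\<alpha>\<close> is a quadratic in \<open>\<alpha>\<close> whose positive leading coefficient and minimiser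
  \<open>\<alpha>\<^sub>2(\<lambda>)\<close> depend on \<open>\<theta>\<close> only through \<open>\<lambda> = \<theta>\<^sub>2 - \<theta>\<^sub>1\<close>. Hence \<open>\<delta>\<^sub>\<alpha>\<close>
  is admissible iff \<open>\<alpha>\<close> lies between the infimum and the supremum of \<open>\<alpha>\<^sub>2\<close>.
  Conditioning on \<open>Z\<close> exhibits \<open>\<alpha>\<^sub>2(\<lambda>)\<close> as the mean of
  \<open>k\<^sub>2(\<cdot>, \<lambda>)\<close> under the weight \<open>u\<^sup>2 f\<^sub>Z(u + c - \<beta> - \<lambda>)\<close> on \<open>u < 0\<close>. Log-concavity (log-convexity)
  of \<open>f\<^sub>Z\<close> makes the likelihood ratio of the weights for two values of \<open>\<lambda>\<close> monotone, and \<open>\<alpha>\<^sub>2\<close> is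
  then monotone by a Chebyshev argument: symmetrising the double integral of the cross
  difference makes its integrand nonnegative, without integrating \<open>k\<^sub>2\<close> for one \<open>\<lambda>\<close> against the
  weight for another, where it need not be integrable.
\<close>

section \<open>Limits of monotone functions at infinity\<close>

text \<open>Shows that the limit behind \<open>alpha2_inf\<close> exists in the increasing case.
  With values in \<open>ereal\<close> the supremum exists even if \<open>alpha2\<close> is
  unbounded.\<close>

lemma tendsto_SUP_at_top:
  fixes A :: "real \<Rightarrow> ereal"
  assumes "mono_on {0..} A"
  shows "(A \<longlongrightarrow> (SUP l\<in>{0..}. A l)) at_top"
proof (rule increasing_tendsto)
  show "\<forall>\<^sub>F l in at_top. A l \<le> (SUP l\<in>{0..}. A l)"
    by (rule eventually_at_top_linorderI[of 0]) (auto intro: SUP_upper)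
next
  fix x assume "x < (SUP l\<in>{0..}. A l)"
  then obtain l0 where l0: "l0 \<ge> 0" "x < A l0"
    by (auto simp: less_SUP_iff)
  show "\<forall>\<^sub>F l in at_top. x < A l"
  proof (rule eventually_at_top_linorderI[of l0])
    fix l assume "l0 \<le> l"
    then have "A l0 \<le> A l" using assms l0 by (auto simp: mono_on_def)
    then show "x < A l" using l0 by order
  qed
qed

lemma tendsto_INF_at_top:
  fixes A :: "real \<Rightarrow> ereal"
  assumes "antimono_on {0..} A"
  shows "(A \<longlongrightarrow> (INF l\<in>{0..}. A l)) at_top"
proof (rule decreasing_tendsto)
  show "\<forall>\<^sub>F l in at_top. (INF l\<in>{0..}. A l) \<le> A l"
    by (rule eventually_at_top_linorderI[of 0]) (auto intro: INF_lower)
next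
  fix x assume "(INF l\<in>{0..}. A l) < x"
  then obtain l0 where l0: "l0 \<ge> 0" "A l0 < x"
    by (auto simp: INF_less_iff)
  show "\<forall>\<^sub>F l in at_top. A l < x"
  proof (rule eventually_at_top_linorderI[of l0])
    fix l assume "l0 \<le> l"
    then have "A l \<le> A l0" using assms l0 by (auto simp: monotone_on_def)
    then show "A l < x" using l0 by order
  qed
qed

section \<open>A Chebyshev inequality for weighted means\<close>

text \<open>Integrating the symmetrised expression over \<open>v\<close> and then over
  \<open>u\<close> yields twice the difference of the two sides. Every term is a product of a
  function of \<open>u\<close> and a function of \<open>v\<close>, so linearity of the iterated
  integral is enough.\<close>

lemma integral_cross_le:
  fixes w1 w2 a1 a2 :: "'a \<Rightarrow> real"
  assumes [simp]: "integrable M w1" "integrable M w2" "integrable M a1" "integrable M a2"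
    and nonneg: "\<And>u v. 0 \<le> a2 u * w1 v - w2 u * a1 v + a2 v * w1 u - w2 v * a1 u"
  shows "integral\<^sup>L M a1 * integral\<^sup>L M w2 \<le> integral\<^sup>L M a2 * integral\<^sup>L M w1"
proof -
  let ?I = "integral\<^sup>L M"
  have inner: "(\<integral>v. (a2 u * w1 v - w2 u * a1 v + a2 v * w1 u - w2 v * a1 u) \<partial>M)
      = a2 u * ?I w1 - w2 u * ?I a1 + ?I a2 * w1 u - ?I w2 * a1 u" for u
    by simp
  have "0 \<le> (\<integral>u. (\<integral>v. (a2 u * w1 v - w2 u * a1 v + a2 v * w1 u - w2 v * a1 u) \<partial>M) \<partial>M)"
    by (intro Bochner_Integration.integral_nonneg nonneg)
  also have "\<dots> = ?I a2 * ?I w1 - ?I w2 * ?I a1 + ?I a2 * ?I w1 - ?I w2 * ?I a1"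
    unfolding inner by simp
  finally show ?thesis by (simp add: mult.commute)
qed

text \<open>
  The order on the index set enters only through the comonotonicity of \<open>K2\<close> and \<open>w2 / w1\<close>, which
  covers an increasing and a decreasing likelihood ratio at once.
\<close>

lemma comonotone_weighted_mean_le:
  fixes w1 w2 K1 K2 :: "'a \<Rightarrow> real"
  assumes "integrable M (\<lambda>u. indicator S u * w1 u)" "integrable M (\<lambda>u. indicator S u * w2 u)"
    and "integrable M (\<lambda>u. indicator S u * (K1 u * w1 u))"
    and "integrable M (\<lambda>u. indicator S u * (K2 u * w2 u))"
    and w: "\<And>u. u \<in> S \<Longrightarrow> 0 \<le> w1 u" "\<And>u. u \<in> S \<Longrightarrow> 0 \<le> w2 u"
    and K: "\<And>u. u \<in> S \<Longrightarrow> K1 u \<le> K2 u"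
    and comonotone: "\<And>u v. u \<in> S \<Longrightarrow> v \<in> S \<Longrightarrow>
          (w2 v * w1 u \<le> w2 u * w1 v \<and> K2 v \<le> K2 u) \<or> (w2 u * w1 v \<le> w2 v * w1 u \<and> K2 u \<le> K2 v)"
  shows "(\<integral>u. indicator S u * (K1 u * w1 u) \<partial>M) * (\<integral>u. indicator S u * w2 u \<partial>M)
       \<le> (\<integral>u. indicator S u * (K2 u * w2 u) \<partial>M) * (\<integral>u. indicator S u * w1 u \<partial>M)"
proof (rule integral_cross_le[OF assms(1-4)])
  \<comment> \<open>Since \<open>K1 v \<le> K2 v \<le> K2 u\<close>, the first coefficient is
    nonnegative. Replacing its factor by the smaller \<open>w2 v * w1 u\<close> leaves a common
    factor times the sum of the gaps \<open>K2 - K1\<close> at \<open>u\<close> and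
    \<open>v\<close>.\<close>
  have key: "0 \<le> (K2 u - K1 v) * (w2 u * w1 v) + (K2 v - K1 u) * (w2 v * w1 u)"
    if uv: "u \<in> S" "v \<in> S" and le: "w2 v * w1 u \<le> w2 u * w1 v" "K2 v \<le> K2 u" for u v
  proof -
    have "(K2 u - K1 v) * (w2 v * w1 u) \<le> (K2 u - K1 v) * (w2 u * w1 v)"
      using le K[OF uv(2)] by (intro mult_left_mono) auto
    moreover have "0 \<le> ((K2 u - K1 u) + (K2 v - K1 v)) * (w2 v * w1 u)"
      using K[OF uv(1)] K[OF uv(2)] w uv by (intro mult_nonneg_nonneg) auto
    ultimately show ?thesis by (simp add: algebra_simps)
  qed
  fix u v
  show "0 \<le> indicator S u * (K2 u * w2 u) * (indicator S v * w1 v)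
      - indicator S u * w2 u * (indicator S v * (K1 v * w1 v))
      + indicator S v * (K2 v * w2 v) * (indicator S u * w1 u)
      - indicator S v * w2 v * (indicator S u * (K1 u * w1 u))"
  proof (cases "u \<in> S \<and> v \<in> S")
    case True
    then show ?thesis using comonotone[of u v] key[of u v] key[of v u]
      by (auto simp: algebra_simps)
  qed (auto simp: indicator_def)
qed

section \<open>Log-concave and log-convex functions at pairs of points with equal sum\<close>

text \<open>The inner points are convex combinations of \<open>p\<close> and \<open>q\<close> with
  the weights \<open>t\<close> and \<open>1 - t\<close> interchanged, so the weights cancel when the
  two concavity inequalities are added.\<close>

lemma concave_on_inner_pair:
  fixes h :: "real \<Rightarrow> real"
  assumes "concave_on S h" "p \<in> S" "q \<in> S" "p \<le> x" "x \<le> q" "x + y = p + q"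
  shows "h p + h q \<le> h x + h y"
proof (cases "p = q")
  case True
  with assms have "x = p" "y = p" by auto
  with True show ?thesis by simp
next
  case False
  with assms have lt: "p < q" by auto
  define t where "t = (x - p) / (q - p)"
  have t: "0 \<le> t" "t \<le> 1" using assms lt by (auto simp: t_def field_simps)
  have tq: "t * (q - p) = x - p" using lt by (simp add: t_def)
  have x: "x = (1 - t) *\<^sub>R p + t *\<^sub>R q" and y: "y = (1 - (1 - t)) *\<^sub>R p + (1 - t) *\<^sub>R q"
    using tq assms(6) by (simp_all add: algebra_simps)
  have "(1 - t) * h p + t * h q \<le> h x"
    unfolding x using assms t by (intro concave_onD) auto
  moreover have "(1 - (1 - t)) * h p + (1 - t) * h q \<le> h y"
    unfolding y using assms t by (intro concave_onD) auto
  ultimately show ?thesis by (simp add: algebra_simps)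
qed

text \<open>This form of log-concavity yields the monotone likelihood ratio of translates of
  \<open>g\<close>.\<close>

lemma log_concave_on_inner_pair:
  assumes g: "log_concave_on S g" and S: "p \<in> S" "q \<in> S" "x \<in> S" "y \<in> S"
    and "p \<le> x" "x \<le> q" "x + y = p + q"
  shows "g p * g q \<le> g x * g y"
proof -
  have "ln (g p) + ln (g q) \<le> ln (g x) + ln (g y)"
    using assms by (intro concave_on_inner_pair[where S=S]) (auto simp: log_concave_on_def)
  moreover have pos: "0 < g p" "0 < g q" "0 < g x" "0 < g y"
    using g S by (auto simp: log_concave_on_def)
  ultimately have "ln (g p * g q) \<le> ln (g x * g y)"
    by (subst (1 2) ln_mult_pos) auto
  with pos show ?thesis by simp
qed

lemma log_convex_on_inner_pair:
  assumes g: "log_convex_on S g" and S: "p \<in> S" "q \<in> S" "x \<in> S" "y \<in> S"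
    and "p \<le> x" "x \<le> q" "x + y = p + q"
  shows "g x * g y \<le> g p * g q"
proof -
  have "- ln (g p) + - ln (g q) \<le> - ln (g x) + - ln (g y)"
    using assms by (intro concave_on_inner_pair[where S=S and h="\<lambda>x. - ln (g x)"])
      (auto simp: log_convex_on_def concave_on_def)
  moreover have pos: "0 < g p" "0 < g q" "0 < g x" "0 < g y"
    using g S by (auto simp: log_convex_on_def)
  ultimately have "ln (g x * g y) \<le> ln (g p * g q)"
    by (subst (1 2) ln_mult_pos) auto
  with pos show ?thesis by simp
qed

section \<open>Products of square integrable functions\<close>

lemma integrable_mult_of_squares:
  fixes g h :: "'a \<Rightarrow> real"
  assumes [measurable]: "g \<in> borel_measurable M" "h \<in> borel_measurable M"
    and "integrable M (\<lambda>x. (g x)\<^sup>2)" "integrable M (\<lambda>x. (h x)\<^sup>2)"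
  shows "integrable M (\<lambda>x. g x * h x)"
proof (rule Bochner_Integration.integrable_bound)
  show "integrable M (\<lambda>x. (g x)\<^sup>2 + (h x)\<^sup>2)" using assms by simp
  have "\<bar>a * b\<bar> \<le> a\<^sup>2 + b\<^sup>2" for a b :: real
    using sum_squares_bound[of "\<bar>a\<bar>" "\<bar>b\<bar>"] mult_nonneg_nonneg[of "\<bar>a\<bar>" "\<bar>b\<bar>"]
    unfolding abs_mult power2_abs by linarith
  then show "AE x in M. norm (g x * h x) \<le> norm ((g x)\<^sup>2 + (h x)\<^sup>2)" by simp
qed measurable

lemma integrable_square_diff:
  fixes g h :: "'a \<Rightarrow> real"
  assumes "g \<in> borel_measurable M" "h \<in> borel_measurable M"
    and "integrable M (\<lambda>x. (g x)\<^sup>2)" "integrable M (\<lambda>x. (h x)\<^sup>2)"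
  shows "integrable M (\<lambda>x. (g x - h x)\<^sup>2)"
  using integrable_mult_of_squares[OF assms] assms(3,4)
  by (simp add: power2_diff mult.assoc)

section \<open>Change of variables from (Z_1, Z_2) to (Z, Z_2)\<close>

text \<open>The map is an involution, so \<open>(z, s) \<mapsto> (s - z, s)\<close> is also its
  inverse. This is the parametrisation of the fibre Z = z used in \<open>psi2\<close>.\<close>

definition shear :: "real \<times> real \<Rightarrow> real \<times> real" where
  "shear x = (snd x - fst x, snd x)"

lemma shear_measurable [measurable]: "shear \<in> borel \<rightarrow>\<^sub>M borel"
  unfolding shear_def[abs_def] by (simp add: borel_prod[symmetric])

text \<open>For a fixed second coordinate \<open>s\<close> the map is the reflection
  \<open>z \<mapsto> s - z\<close> of the line, which preserves Lebesgue measure; Tonelli does the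
  rest.\<close>

lemma lborel_distr_shear: "distr lborel borel shear = lborel"
proof (rule measure_eqI)
  fix A :: "(real \<times> real) set"
  assume "A \<in> sets (distr lborel borel shear)"
  then have [measurable]: "A \<in> sets borel" by simp
  have [measurable]: "(\<lambda>x. indicator A x :: ennreal) \<in> borel_measurable (borel \<Otimes>\<^sub>M borel)"
    "(\<lambda>x. indicator A (shear x) :: ennreal) \<in> borel_measurable (borel \<Otimes>\<^sub>M borel)"
    by (simp_all add: borel_prod)
  have "emeasure (distr lborel borel shear) A = (\<integral>\<^sup>+x. indicator A x \<partial>distr lborel borel shear)"
    by simp
  also have "\<dots> = (\<integral>\<^sup>+x. indicator A (shear x) \<partial>lborel)"
    by (rule nn_integral_distr) auto
  also have "\<dots> = (\<integral>\<^sup>+s. (\<integral>\<^sup>+z. indicator A (s - z, s) \<partial>lborel) \<partial>lborel)"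
    unfolding lborel_prod[symmetric]
    by (subst lborel_pair.nn_integral_snd[symmetric]) (auto simp: shear_def)
  also have "\<dots> = (\<integral>\<^sup>+s. (\<integral>\<^sup>+z. indicator A (z, s) \<partial>lborel) \<partial>lborel)"
  proof (rule nn_integral_cong)
    fix s :: real
    show "(\<integral>\<^sup>+z. indicator A (s - z, s) \<partial>lborel) = (\<integral>\<^sup>+z. indicator A (z, s) \<partial>lborel)"
      by (subst (2) nn_integral_real_affine[where c="-1" and t=s]) auto
  qed
  also have "\<dots> = (\<integral>\<^sup>+x. indicator A x \<partial>(lborel \<Otimes>\<^sub>M lborel))"
    by (rule lborel_pair.nn_integral_snd) auto
  finally show "emeasure (distr lborel borel shear) A = emeasure lborel A"
    by (simp add: lborel_prod)
qed simp

text \<open>Fubini after the change of variables: the inner integral runs along the fibre Z = z, the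
  outer one over z.\<close>

lemma shear_integral:
  fixes G :: "real \<times> real \<Rightarrow> real"
  assumes "integrable lborel G"
  shows "integrable lborel (\<lambda>z. \<integral>s. G (s - z, s) \<partial>lborel)"
    and "(\<integral>x. G x \<partial>lborel) = (\<integral>z. (\<integral>s. G (s - z, s) \<partial>lborel) \<partial>lborel)"
proof -
  have [measurable]: "G \<in> borel_measurable borel" using assms by auto
  have "integrable (distr lborel borel shear) G"
    using assms by (simp add: lborel_distr_shear)
  then have "integrable lborel (\<lambda>x. G (shear x))"
    by (subst (asm) integrable_distr_eq) auto
  then have int: "integrable (lborel \<Otimes>\<^sub>M lborel) (\<lambda>(z, s). G (s - z, s))"
    by (simp add: lborel_prod split_beta' shear_def)
  show "integrable lborel (\<lambda>z. \<integral>s. G (s - z, s) \<partial>lborel)"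
    using lborel_pair.integrable_fst[OF int] .
  have "(\<integral>x. G x \<partial>lborel) = (\<integral>x. G x \<partial>distr lborel borel shear)"
    by (simp add: lborel_distr_shear)
  also have "\<dots> = (\<integral>x. G (shear x) \<partial>lborel)"
    by (rule integral_distr) auto
  also have "\<dots> = (\<integral>(z, s). G (s - z, s) \<partial>(lborel \<Otimes>\<^sub>M lborel))"
    by (simp add: lborel_prod split_beta' shear_def)
  also have "\<dots> = (\<integral>z. (\<integral>s. G (s - z, s) \<partial>lborel) \<partial>lborel)"
    using lborel_pair.integral_fst[OF int] by simp
  finally show "(\<integral>x. G x \<partial>lborel) = (\<integral>z. (\<integral>s. G (s - z, s) \<partial>lborel) \<partial>lborel)" .
qed

lemma fst_snd_borel [measurable]:
  "fst \<in> borel_measurable (borel :: (real \<times> real) measure)"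
  "snd \<in> borel_measurable (borel :: (real \<times> real) measure)"
  by (auto intro!: borel_measurable_continuous_onI continuous_intros)

lemma sets_noise_dist [measurable_cong, simp]: "sets (noise_dist f) = sets borel"
  by (simp add: noise_dist_def)

section \<open>The model; numerator and denominator of \<open>alpha2\<close> as weighted
  integrals\<close>

text \<open>Finiteness of \<open>fZ\<close> and \<open>psi2\<close> is expressed as integrability,
  because the Bochner integral of a non-integrable function is 0 and its value alone would say
  nothing.\<close>

locale location_model =
  fixes f :: "real \<times> real \<Rightarrow> real" and \<beta> :: real
  assumes f_borel [measurable]: "f \<in> borel_measurable borel"
    and f_nonneg: "\<And>x. 0 \<le> f x"
    and f_prob: "prob_space (noise_dist f)"
    and moment1: "integrable (noise_dist f) (\<lambda>z. (fst z)\<^sup>2)"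
    and moment2: "integrable (noise_dist f) (\<lambda>z. (snd z)\<^sup>2)"
    and fZ_finite: "\<And>z. z < c02 f - \<beta> \<Longrightarrow> integrable lborel (\<lambda>s. f (s, s + z))"
    and fZ_pos: "\<And>z. z < c02 f - \<beta> \<Longrightarrow> 0 < fZ f z"
    and psi2_finite: "\<And>z. z < c02 f - \<beta> \<Longrightarrow> integrable lborel (\<lambda>s. s * f (s - z, s))"
begin

sublocale noise: prob_space "noise_dist f"
  by (rule f_prob)

text \<open>For an observation X with \<theta>_2 - \<theta>_1 = \<open>l\<close> this is the minimum
  of 0 and (X_2 - c_{0,2}) - (X_1 - \<beta>). The error of \<delta>_\<alpha> is therefore
  \<open>(snd z - c02 f) - \<alpha> * excess l z\<close>.\<close>

definition excess :: "real \<Rightarrow> real \<times> real \<Rightarrow> real" where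
  "excess l z = ((snd z - fst z) + l + \<beta> - c02 f) * indicator {..<c02 f - \<beta> - l} (snd z - fst z)"

definition num :: "real \<Rightarrow> real" where
  "num l = (\<integral>z. (snd z - c02 f) * excess l z \<partial>noise_dist f)"

definition den :: "real \<Rightarrow> real" where
  "den l = (\<integral>z. (excess l z)\<^sup>2 \<partial>noise_dist f)"

lemma alpha2_eq: "alpha2 f \<beta> l = num l / den l"
proof -
  have "(indicator A x :: real)\<^sup>2 = indicator A x" for A :: "real set" and x
    by (simp add: indicator_def)
  then show ?thesis
    unfolding alpha2_def num_def den_def excess_def power_mult_distrib by (simp add: mult.assoc)
qed

lemma excess_measurable [measurable]: "excess l \<in> borel_measurable borel"
  unfolding excess_def by measurable

lemma square_integrable_centered: "integrable (noise_dist f) (\<lambda>z. (snd z - c02 f)\<^sup>2)"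
  by (rule integrable_square_diff) (use moment2 in auto)

lemma square_integrable_excess: "integrable (noise_dist f) (\<lambda>z. (excess l z)\<^sup>2)"
proof (rule Bochner_Integration.integrable_bound)
  have "integrable (noise_dist f) (\<lambda>z. (snd z - fst z - (c02 f - \<beta> - l))\<^sup>2)"
    by (intro integrable_square_diff moment1 moment2) auto
  then show "integrable (noise_dist f) (\<lambda>z. ((snd z - fst z) + l + \<beta> - c02 f)\<^sup>2)"
    by (simp add: algebra_simps)
  show "AE z in noise_dist f. norm ((excess l z)\<^sup>2) \<le> norm (((snd z - fst z) + l + \<beta> - c02 f)\<^sup>2)"
    by (simp add: excess_def indicator_def)
qed measurable

lemma integrable_centered_excess: "integrable (noise_dist f) (\<lambda>z. (snd z - c02 f) * excess l z)"
  by (rule integrable_mult_of_squares)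
    (use square_integrable_centered square_integrable_excess in auto)

lemma noise_integral_lborel:
  fixes G :: "real \<times> real \<Rightarrow> real"
  assumes [measurable]: "G \<in> borel_measurable borel"
  shows "(\<integral>x. G x \<partial>noise_dist f) = (\<integral>x. f x * G x \<partial>lborel)"
    and "integrable (noise_dist f) G \<longleftrightarrow> integrable lborel (\<lambda>x. f x * G x)"
  unfolding noise_dist_def
  by (simp_all add: integral_real_density integrable_real_density f_nonneg)

text \<open>The shift by \<open>c02 f - \<beta> - l\<close> moves the region where
  \<open>excess l\<close> is nonzero onto the half-line \<open>u < 0\<close>, the same for all
  \<open>l\<close>. Integrals for different \<open>l\<close> can then be compared pointwise.\<close>

lemma noise_integral_shear:
  fixes G :: "real \<times> real \<Rightarrow> real"
  assumes "integrable (noise_dist f) G"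
    and inner: "\<And>z. (\<integral>s. f (s - z, s) * G (s - z, s) \<partial>lborel) = H (z - (c02 f - \<beta> - l))"
  shows "integrable lborel H" and "(\<integral>x. G x \<partial>noise_dist f) = integral\<^sup>L lborel H"
proof -
  let ?t = "c02 f - \<beta> - l"
  have [measurable]: "G \<in> borel_measurable borel" using assms(1) by auto
  have "integrable lborel (\<lambda>x. f x * G x)" using assms(1) noise_integral_lborel by simp
  note sh = shear_integral[OF this, unfolded inner]
  have "integrable lborel (\<lambda>u. H (?t + 1 * u - ?t))"
    by (rule lborel_integrable_real_affine[where f="\<lambda>z. H (z - ?t)"]) (use sh(1) in auto)
  then show "integrable lborel H" by simp
  have "(\<integral>x. G x \<partial>noise_dist f) = (\<integral>z. H (z - ?t) \<partial>lborel)"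
    using sh(2) noise_integral_lborel by simp
  also have "\<dots> = (\<integral>u. H (?t + 1 * u - ?t) \<partial>lborel)"
    using lborel_integral_real_affine[where f="\<lambda>z. H (z - ?t)" and c=1 and t="?t"] by simp
  finally show "(\<integral>x. G x \<partial>noise_dist f) = integral\<^sup>L lborel H" by simp
qed

text \<open>Translating \<open>s\<close> by \<open>z\<close> identifies the fibre parametrisations
  in \<open>fZ\<close> and \<open>psi2\<close>. Hence the denominator of \<open>psi2\<close> is
  \<open>fZ f z\<close>, which is positive and cancels.\<close>

lemma
  assumes "z < c02 f - \<beta>"
  shows integral_section: "(\<integral>s. f (s - z, s) \<partial>lborel) = fZ f z"
    and integral_section_centered:
      "(\<integral>s. f (s - z, s) * (s - c02 f) \<partial>lborel) = (psi2 f z - c02 f) * fZ f z"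
proof -
  have "integrable lborel (\<lambda>s. f (- z + 1 * s, - z + 1 * s + z))"
    by (rule lborel_integrable_real_affine[where f="\<lambda>s. f (s, s + z)"])
      (use fZ_finite[OF assms] in auto)
  then have int: "integrable lborel (\<lambda>s. f (s - z, s))" by simp
  show eq: "(\<integral>s. f (s - z, s) \<partial>lborel) = fZ f z"
    unfolding fZ_def
    using lborel_integral_real_affine[where f="\<lambda>s. f (s, s + z)" and c=1 and t="-z"] by simp
  have "(\<integral>s. f (s - z, s) * (s - c02 f) \<partial>lborel)
      = (\<integral>s. s * f (s - z, s) - c02 f * f (s - z, s) \<partial>lborel)"
    by (simp add: algebra_simps)
  also have "\<dots> = (\<integral>s. s * f (s - z, s) \<partial>lborel) - c02 f * fZ f z"
    using int psi2_finite[OF assms] by (simp add: eq)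
  also have "\<dots> = (psi2 f z - c02 f) * fZ f z"
    using fZ_pos[OF assms] by (simp add: psi2_def eq field_simps)
  finally show "(\<integral>s. f (s - z, s) * (s - c02 f) \<partial>lborel) = (psi2 f z - c02 f) * fZ f z" .
qed

text \<open>Here \<open>u\<close> is the value of \<open>excess l\<close> on its fibre: the squared
  excess times the density of Z at that fibre.\<close>

definition weight :: "real \<Rightarrow> real \<Rightarrow> real" where
  "weight l u = u\<^sup>2 * fZ f (u + c02 f - \<beta> - l)"

lemma den_weight:
  assumes "0 \<le> l"
  shows "integrable lborel (\<lambda>u. indicator {..<0} u * weight l u)"
    and "den l = (\<integral>u. indicator {..<0} u * weight l u \<partial>lborel)"
proof -
  have inner: "(\<integral>s. f (s - z, s) * (excess l (s - z, s))\<^sup>2 \<partial>lborel)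
      = indicator {..<0} (z - (c02 f - \<beta> - l)) * weight l (z - (c02 f - \<beta> - l))" for z
  proof (cases "z < c02 f - \<beta> - l")
    case True
    then have "z < c02 f - \<beta>" using assms by simp
    with True show ?thesis
      by (simp add: excess_def weight_def integral_section algebra_simps)
  qed (simp add: excess_def)
  show "integrable lborel (\<lambda>u. indicator {..<0} u * weight l u)"
    by (rule noise_integral_shear(1)[OF square_integrable_excess inner])
  show "den l = (\<integral>u. indicator {..<0} u * weight l u \<partial>lborel)"
    unfolding den_def by (rule noise_integral_shear(2)[OF square_integrable_excess inner])
qed

text \<open>On a fibre the excess is the constant \<open>u\<close>, and the integral of the other
  factor is \<open>(psi2 f z - c02 f) * fZ f z\<close> with
  \<open>psi2 f z - c02 f = u * k2 f \<beta> u l\<close>. The two factors \<open>u\<close> form the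
  square in \<open>weight\<close>.\<close>

lemma num_weight:
  assumes "0 \<le> l"
  shows "integrable lborel (\<lambda>u. indicator {..<0} u * (k2 f \<beta> u l * weight l u))"
    and "num l = (\<integral>u. indicator {..<0} u * (k2 f \<beta> u l * weight l u) \<partial>lborel)"
proof -
  have inner: "(\<integral>s. f (s - z, s) * ((s - c02 f) * excess l (s - z, s)) \<partial>lborel)
      = indicator {..<0} (z - (c02 f - \<beta> - l)) *
        (k2 f \<beta> (z - (c02 f - \<beta> - l)) l * weight l (z - (c02 f - \<beta> - l)))" for z
  proof (cases "z < c02 f - \<beta> - l")
    case True
    define u where "u = z - (c02 f - \<beta> - l)"
    have z: "z = u + c02 f - \<beta> - l" and u: "u < 0" using True by (auto simp: u_def)
    have "z < c02 f - \<beta>" using True assms by simp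
    have "(\<integral>s. f (s - z, s) * ((s - c02 f) * excess l (s - z, s)) \<partial>lborel)
        = (\<integral>s. f (s - z, s) * (s - c02 f) * u \<partial>lborel)"
      using True by (simp add: excess_def u_def algebra_simps)
    also have "\<dots> = (psi2 f z - c02 f) * fZ f z * u"
      using integral_section_centered[OF \<open>z < c02 f - \<beta>\<close>] by simp
    also have "\<dots> = k2 f \<beta> u l * weight l u"
      using u by (simp add: k2_def weight_def z[symmetric] power2_eq_square)
    finally show ?thesis using u by (simp add: u_def[symmetric])
  qed (simp add: excess_def)
  have int: "integrable (noise_dist f) (\<lambda>x. (snd x - c02 f) * excess l x)"
    by (rule integrable_centered_excess)
  note r = noise_integral_shear[OF int, where H="\<lambda>u. indicator {..<0} u * (k2 f \<beta> u l * weight l u)" and l=l]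
  show "integrable lborel (\<lambda>u. indicator {..<0} u * (k2 f \<beta> u l * weight l u))"
    by (rule r(1)) (simp add: inner)
  show "num l = (\<integral>u. indicator {..<0} u * (k2 f \<beta> u l * weight l u) \<partial>lborel)"
    unfolding num_def by (rule r(2)) (simp add: inner)
qed

lemma weight_pos: "0 \<le> l \<Longrightarrow> u < 0 \<Longrightarrow> 0 < weight l u"
  by (auto simp: weight_def intro!: mult_pos_pos fZ_pos)

text \<open>A vanishing integral would force the weight to be 0 almost everywhere on
  \<open>u < 0\<close>, whereas it is positive on the whole half-line, in particular on an interval
  of measure 1.\<close>

lemma den_pos:
  assumes l: "0 \<le> l"
  shows "0 < den l"
proof -
  let ?w = "\<lambda>u. indicator {..<0} u * weight l u"
  have nonneg: "0 \<le> ?w u" for u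
    using weight_pos[OF l, of u] by (auto simp: indicator_def)
  have "den l \<noteq> 0"
  proof
    assume "den l = 0"
    then have "AE u in lborel. ?w u = 0"
      using integral_nonneg_eq_0_iff_AE[OF den_weight(1)[OF l]] nonneg den_weight(2)[OF l] by simp
    then have "AE u in lborel. u \<notin> {-1<..<0::real}"
      by eventually_elim (use weight_pos[OF l] in \<open>force simp: indicator_def\<close>)
    then have "emeasure lborel {-1<..<0::real} = 0"
      by (subst (asm) AE_iff_measurable[where N="{-1<..<0}"]) auto
    then show False by simp
  qed
  moreover have "0 \<le> den l"
    unfolding den_def by simp
  ultimately show ?thesis by simp
qed

section \<open>The risk as a quadratic in \<alpha>\<close>

lemma obs_dist_integral:
  fixes g :: "real \<times> real \<Rightarrow> real"
  assumes [measurable]: "g \<in> borel_measurable borel"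
  shows "(\<integral>x. g x \<partial>obs_dist f \<theta>) = (\<integral>z. g (\<theta> + z) \<partial>noise_dist f)"
proof -
  have "(\<integral>x. g x \<partial>obs_dist f \<theta>) = (\<integral>x. f (x - \<theta>) * g x \<partial>lborel)"
    unfolding obs_dist_def minus_prod_def
    by (simp add: integral_real_density f_nonneg minus_prod_def[symmetric])
  also have "\<dots> = (\<integral>x. f (x - \<theta>) * g x \<partial>distr lborel borel ((+) \<theta>))"
    by (simp add: lborel_distr_plus)
  also have "\<dots> = (\<integral>z. f z * g (\<theta> + z) \<partial>lborel)"
    by (subst integral_distr) auto
  also have "\<dots> = (\<integral>z. g (\<theta> + z) \<partial>noise_dist f)"
    by (simp add: noise_integral_lborel)
  finally show ?thesis .
qed

lemma risk_eq:
  "R2 f \<theta> (delta_est f \<beta> a) = (\<integral>z. (snd z - c02 f)\<^sup>2 \<partial>noise_dist f)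
     - 2 * a * num (snd \<theta> - fst \<theta>) + a\<^sup>2 * den (snd \<theta> - fst \<theta>)"
proof -
  let ?l = "snd \<theta> - fst \<theta>"
  \<comment> \<open>The two cases of the estimator match the indicator: X_1 - \<beta> exceeds X_2 -
    c_{0,2} exactly when Z < c_{0,2} - \<beta> - \<lambda>.\<close>
  have err: "delta_est f \<beta> a (\<theta> + z) - snd \<theta> = (snd z - c02 f) - a * excess ?l z" for z
    by (auto simp: delta_est_def excess_def indicator_def algebra_simps)
  have [measurable]: "delta_est f \<beta> a \<in> borel_measurable borel"
    unfolding delta_est_def[abs_def] by measurable
  have "R2 f \<theta> (delta_est f \<beta> a) = (\<integral>z. ((snd z - c02 f) - a * excess ?l z)\<^sup>2 \<partial>noise_dist f)"
    unfolding R2_def by (subst obs_dist_integral) (auto simp: err)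
  also have "\<dots> = (\<integral>z. (snd z - c02 f)\<^sup>2 - 2 * a * ((snd z - c02 f) * excess ?l z)
      + a\<^sup>2 * (excess ?l z)\<^sup>2 \<partial>noise_dist f)"
    by (simp add: power2_eq_square algebra_simps)
  also have "\<dots> = (\<integral>z. (snd z - c02 f)\<^sup>2 \<partial>noise_dist f) - 2 * a * num ?l + a\<^sup>2 * den ?l"
    using square_integrable_centered square_integrable_excess integrable_centered_excess
    by (simp add: num_def den_def)
  finally show ?thesis .
qed

text \<open>With \<open>num l = alpha2 f \<beta> l * den l\<close> the difference of the two
  quadratics factors. Its sign depends only on the order of \<open>a\<close> and \<open>b\<close>
  and on the position of their midpoint relative to the minimiser.\<close>

lemma risk_diff:
  assumes "\<theta> \<in> Theta0"
  defines "l \<equiv> snd \<theta> - fst \<theta>"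
  shows "R2 f \<theta> (delta_est f \<beta> b) - R2 f \<theta> (delta_est f \<beta> a)
    = den l * ((b - a) * (a + b - 2 * alpha2 f \<beta> l))"
proof -
  have "0 < den l" using assms by (intro den_pos) (auto simp: Theta0_def)
  then have "num l = alpha2 f \<beta> l * den l" by (simp add: alpha2_eq)
  then show ?thesis
    unfolding risk_eq l_def[symmetric] by (simp add: power2_eq_square algebra_simps)
qed

lemma risk_le_iff:
  assumes "\<theta> \<in> Theta0"
  shows "R2 f \<theta> (delta_est f \<beta> b) \<le> R2 f \<theta> (delta_est f \<beta> a)
    \<longleftrightarrow> (b - a) * (a + b - 2 * alpha2 f \<beta> (snd \<theta> - fst \<theta>)) \<le> 0"
    and "R2 f \<theta> (delta_est f \<beta> b) < R2 f \<theta> (delta_est f \<beta> a)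
    \<longleftrightarrow> (b - a) * (a + b - 2 * alpha2 f \<beta> (snd \<theta> - fst \<theta>)) < 0"
proof -
  have "0 < den (snd \<theta> - fst \<theta>)" using assms by (intro den_pos) (auto simp: Theta0_def)
  then show "R2 f \<theta> (delta_est f \<beta> b) \<le> R2 f \<theta> (delta_est f \<beta> a)
    \<longleftrightarrow> (b - a) * (a + b - 2 * alpha2 f \<beta> (snd \<theta> - fst \<theta>)) \<le> 0"
    and "R2 f \<theta> (delta_est f \<beta> b) < R2 f \<theta> (delta_est f \<beta> a)
    \<longleftrightarrow> (b - a) * (a + b - 2 * alpha2 f \<beta> (snd \<theta> - fst \<theta>)) < 0"
    using risk_diff[OF assms, of b a]
    by (smt (verit) mult_le_0_iff, smt (verit) mult_less_0_iff)
qed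

text \<open>Risk comparisons depend on \<theta> through \<lambda> alone, so they become conditions
  on the real function \<open>alpha2 f \<beta>\<close>.\<close>

lemma Theta0_ball: "(\<forall>\<theta>\<in>Theta0. P (snd \<theta> - fst \<theta>)) \<longleftrightarrow> (\<forall>l\<ge>0. P l)"
proof
  assume P: "\<forall>\<theta>\<in>Theta0. P (snd \<theta> - fst \<theta>)"
  show "\<forall>l\<ge>0. P l"
  proof (intro allI impI)
    fix l :: real assume "0 \<le> l"
    then show "P l" using bspec[OF P, of "(0, l)"] by (simp add: Theta0_def)
  qed
qed (simp add: Theta0_def)

lemma dominates_iff:
  "dominates f (delta_est f \<beta> b) (delta_est f \<beta> a)
    \<longleftrightarrow> (\<forall>l\<ge>0. (b - a) * (a + b - 2 * alpha2 f \<beta> l) \<le> 0)"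
  unfolding dominates_def Theta0_ball[symmetric] by (rule ball_cong) (simp_all only: risk_le_iff)

lemma strictly_better_iff:
  "(\<exists>\<theta>\<in>Theta0. R2 f \<theta> (delta_est f \<beta> b) < R2 f \<theta> (delta_est f \<beta> a))
    \<longleftrightarrow> (\<exists>l\<ge>0. (b - a) * (a + b - 2 * alpha2 f \<beta> l) < 0)"
  using Theta0_ball[of "\<lambda>l. \<not> (b - a) * (a + b - 2 * alpha2 f \<beta> l) < 0"] risk_le_iff(2) by blast

lemma admissible_iff:
  "admissible_in f (D2 f \<beta>) (delta_est f \<beta> a) \<longleftrightarrow>
    \<not> (\<exists>b. (\<forall>l\<ge>0. (b - a) * (a + b - 2 * alpha2 f \<beta> l) \<le> 0) \<and>
           (\<exists>l\<ge>0. (b - a) * (a + b - 2 * alpha2 f \<beta> l) < 0))"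
proof -
  have "admissible_in f (D2 f \<beta>) (delta_est f \<beta> a) \<longleftrightarrow>
    \<not> (\<exists>b. dominates f (delta_est f \<beta> b) (delta_est f \<beta> a) \<and>
      (\<exists>\<theta>\<in>Theta0. R2 f \<theta> (delta_est f \<beta> b) < R2 f \<theta> (delta_est f \<beta> a)))"
    unfolding admissible_in_def D2_def dominates_def by auto
  then show ?thesis unfolding dominates_iff strictly_better_iff .
qed

section \<open>Admissibility and the range of \<open>alpha2\<close>\<close>

abbreviation alpha_inf :: ereal where
  "alpha_inf \<equiv> (INF l\<in>{0..}. ereal (alpha2 f \<beta> l))"

abbreviation alpha_sup :: ereal where
  "alpha_sup \<equiv> (SUP l\<in>{0..}. ereal (alpha2 f \<beta> l))"

lemma le_alpha_inf_iff: "ereal a \<le> alpha_inf \<longleftrightarrow> (\<forall>l\<ge>0. a \<le> alpha2 f \<beta> l)"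
  by (auto simp: le_INF_iff)

lemma alpha_sup_le_iff: "alpha_sup \<le> ereal a \<longleftrightarrow> (\<forall>l\<ge>0. alpha2 f \<beta> l \<le> a)"
  by (auto simp: SUP_le_iff)

text \<open>Here \<open>b\<close> lies between \<open>a\<close> and every minimiser, possibly
  coinciding with it, so passing from \<open>a\<close> to \<open>b\<close> moves down every risk
  parabola.\<close>

lemma dominates_toward_range:
  assumes "(a < b \<and> ereal b \<le> alpha_inf) \<or> (alpha_sup \<le> ereal b \<and> b < a)"
  shows "dominates f (delta_est f \<beta> b) (delta_est f \<beta> a)"
  unfolding dominates_iff
proof (intro allI impI)
  fix l :: real assume "0 \<le> l"
  with assms have "(a < b \<and> b \<le> alpha2 f \<beta> l) \<or> (alpha2 f \<beta> l \<le> b \<and> b < a)"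
    unfolding le_alpha_inf_iff alpha_sup_le_iff by auto
  then show "(b - a) * (a + b - 2 * alpha2 f \<beta> l) \<le> 0"
    by (auto simp: mult_le_0_iff)
qed

text \<open>Outside the range, any \<open>b\<close> strictly between \<open>a\<close> and the range
  is better at every \<lambda>. Inside, a competitor that is nowhere worse would put all minimisers
  on the far side of the midpoint of \<open>a\<close> and \<open>b\<close>, which excludes
  \<open>a\<close> from the range.\<close>

lemma admissible_iff_in_range:
  "admissible_in f (D2 f \<beta>) (delta_est f \<beta> a) \<longleftrightarrow> alpha_inf \<le> ereal a \<and> ereal a \<le> alpha_sup"
proof
  assume adm: "admissible_in f (D2 f \<beta>) (delta_est f \<beta> a)"
  show "alpha_inf \<le> ereal a \<and> ereal a \<le> alpha_sup"
  proof (rule ccontr)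
    assume "\<not> ?thesis"
    then consider "ereal a < alpha_inf" | "alpha_sup < ereal a" by force
    then have "\<exists>b. \<forall>l\<ge>0. (b - a) * (a + b - 2 * alpha2 f \<beta> l) < 0"
    proof cases
      case 1
      then obtain b where b: "a < b" "ereal b < alpha_inf"
        using ereal_dense2[of "ereal a" alpha_inf] by auto
      have "a + b - 2 * alpha2 f \<beta> l < 0" if "0 \<le> l" for l
        using b le_alpha_inf_iff[of b, THEN iffD1, OF less_imp_le[OF b(2)], rule_format, OF that]
        by linarith
      then show ?thesis using b by (intro exI[of _ b]) (simp add: mult_pos_neg)
    next
      case 2
      then obtain b where b: "b < a" "alpha_sup < ereal b"
        using ereal_dense2[of alpha_sup "ereal a"] by auto
      have "0 < a + b - 2 * alpha2 f \<beta> l" if "0 \<le> l" for l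
        using b alpha_sup_le_iff[of b, THEN iffD1, OF less_imp_le[OF b(2)], rule_format, OF that]
        by linarith
      then show ?thesis using b by (intro exI[of _ b]) (simp add: mult_neg_pos)
    qed
    then obtain b where b: "\<And>l. 0 \<le> l \<Longrightarrow> (b - a) * (a + b - 2 * alpha2 f \<beta> l) < 0" by blast
    have "(\<forall>l\<ge>0. (b - a) * (a + b - 2 * alpha2 f \<beta> l) \<le> 0) \<and>
        (\<exists>l\<ge>0. (b - a) * (a + b - 2 * alpha2 f \<beta> l) < 0)"
      using b less_imp_le[OF b] b[of 0] by (intro conjI allI impI exI[of _ 0]) auto
    with adm show False unfolding admissible_iff by (elim notE) (rule exI)
  qed
next
  assume range: "alpha_inf \<le> ereal a \<and> ereal a \<le> alpha_sup"
  show "admissible_in f (D2 f \<beta>) (delta_est f \<beta> a)"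
    unfolding admissible_iff
  proof safe
    fix b l assume le: "\<forall>l\<ge>0. (b - a) * (a + b - 2 * alpha2 f \<beta> l) \<le> 0"
      and lt: "(b - a) * (a + b - 2 * alpha2 f \<beta> l) < 0"
    \<comment> \<open>The strict gain at one \<open>l\<close> serves only to exclude
      \<open>b = a\<close>.\<close>
    consider "a < b" | "b < a" using lt by fastforce
    then show False
    proof cases
      case 1
      then have "\<forall>l\<ge>0. (a + b) / 2 \<le> alpha2 f \<beta> l" using le by (fastforce simp: mult_le_0_iff)
      then have "ereal ((a + b) / 2) \<le> alpha_inf" unfolding le_alpha_inf_iff .
      with range have "ereal ((a + b) / 2) \<le> ereal a" by (meson order_trans)
      with 1 show False by simp
    next
      case 2
      then have "\<forall>l\<ge>0. alpha2 f \<beta> l \<le> (a + b) / 2" using le by (fastforce simp: mult_le_0_iff)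
      then have "alpha_sup \<le> ereal ((a + b) / 2)" unfolding alpha_sup_le_iff .
      with range have "ereal a \<le> ereal ((a + b) / 2)" by (meson order_trans)
      with 2 show False by simp
    qed
  qed
qed

lemma admissible_set:
  "{\<delta>. admissible_in f (D2 f \<beta>) \<delta>} =
    {delta_est f \<beta> a | a. alpha_inf \<le> ereal a \<and> ereal a \<le> alpha_sup}"
proof (intro subset_antisym subsetI)
  fix \<delta> assume "\<delta> \<in> {\<delta>. admissible_in f (D2 f \<beta>) \<delta>}"
  then have adm: "admissible_in f (D2 f \<beta>) \<delta>" by simp
  then have "\<delta> \<in> D2 f \<beta>" unfolding admissible_in_def by simp
  then obtain a where "\<delta> = delta_est f \<beta> a" unfolding D2_def by blast
  with adm admissible_iff_in_range[of a]
  show "\<delta> \<in> {delta_est f \<beta> a | a. alpha_inf \<le> ereal a \<and> ereal a \<le> alpha_sup}" by blast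
next
  fix \<delta> assume "\<delta> \<in> {delta_est f \<beta> a | a. alpha_inf \<le> ereal a \<and> ereal a \<le> alpha_sup}"
  then obtain a where "\<delta> = delta_est f \<beta> a" "alpha_inf \<le> ereal a \<and> ereal a \<le> alpha_sup"
    by blast
  with admissible_iff_in_range[of a] show "\<delta> \<in> {\<delta>. admissible_in f (D2 f \<beta>) \<delta>}" by simp
qed

section \<open>Monotonicity of \<open>alpha2\<close>\<close>

text \<open>The sign \<open>s\<close> is \<open>1\<close> for the increasing and \<open>-1\<close> for the decreasing case.\<close>

lemma alpha2_le:
  fixes s :: real
  assumes l: "0 \<le> l1" "0 \<le> l2"
    and K: "\<And>u. u < 0 \<Longrightarrow> s * k2 f \<beta> u l1 \<le> s * k2 f \<beta> u l2"
    and comonotone: "\<And>u v. v \<le> u \<Longrightarrow> u < 0 \<Longrightarrow>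
          (weight l2 v * weight l1 u \<le> weight l2 u * weight l1 v \<and> s * k2 f \<beta> v l2 \<le> s * k2 f \<beta> u l2) \<or>
          (weight l2 u * weight l1 v \<le> weight l2 v * weight l1 u \<and> s * k2 f \<beta> u l2 \<le> s * k2 f \<beta> v l2)"
  shows "s * alpha2 f \<beta> l1 \<le> s * alpha2 f \<beta> l2"
proof -
  have int: "integrable lborel (\<lambda>u. indicator {..<0} u * (s * k2 f \<beta> u l * weight l u))"
    and num: "(\<integral>u. indicator {..<0} u * (s * k2 f \<beta> u l * weight l u) \<partial>lborel) = s * num l"
    if "0 \<le> l" for l
  proof -
    have "(\<lambda>u. indicator {..<0} u * (s * k2 f \<beta> u l * weight l u))
        = (\<lambda>u. s * (indicator {..<0} u * (k2 f \<beta> u l * weight l u)))"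
      by (simp add: algebra_simps)
    then show "integrable lborel (\<lambda>u. indicator {..<0} u * (s * k2 f \<beta> u l * weight l u))"
      "(\<integral>u. indicator {..<0} u * (s * k2 f \<beta> u l * weight l u) \<partial>lborel) = s * num l"
      using num_weight[OF that] by simp_all
  qed
  have "s * num l1 * den l2 \<le> s * num l2 * den l1"
    unfolding num[OF l(1), symmetric] num[OF l(2), symmetric]
      den_weight(2)[OF l(1)] den_weight(2)[OF l(2)]
  proof (rule comonotone_weighted_mean_le)
    \<comment> \<open>The disjunction is symmetric under exchanging \<open>u\<close> and
      \<open>v\<close>, so the assumption for ordered pairs covers all pairs.\<close>
    show "(weight l2 v * weight l1 u \<le> weight l2 u * weight l1 v \<and> s * k2 f \<beta> v l2 \<le> s * k2 f \<beta> u l2) \<or>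
          (weight l2 u * weight l1 v \<le> weight l2 v * weight l1 u \<and> s * k2 f \<beta> u l2 \<le> s * k2 f \<beta> v l2)"
      if "u \<in> {..<0}" "v \<in> {..<0}" for u v
      using comonotone[of u v] comonotone[of v u] that by (cases "v \<le> u") auto
  qed (use l K weight_pos den_weight int in \<open>auto intro: less_imp_le\<close>)
  then show ?thesis
    using den_pos[OF l(1)] den_pos[OF l(2)] by (simp add: alpha2_eq field_simps)
qed

text \<open>Among the four arguments of \<open>fZ f\<close> the one with \<open>v\<close> and
  \<open>l2\<close> is the smallest and the one with \<open>u\<close> and \<open>l1\<close> the
  largest; the other two have the same sum. The factor \<open>u\<^sup>2 * v\<^sup>2\<close> is
  common to both sides.\<close>

lemma weight_log_concave:
  assumes "log_concave_on {..<c02 f - \<beta>} (fZ f)" "0 \<le> l1" "l1 \<le> l2" "v \<le> u" "u < 0"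
  shows "weight l2 v * weight l1 u \<le> weight l2 u * weight l1 v"
proof -
  have "fZ f (v + c02 f - \<beta> - l2) * fZ f (u + c02 f - \<beta> - l1)
      \<le> fZ f (u + c02 f - \<beta> - l2) * fZ f (v + c02 f - \<beta> - l1)"
    by (rule log_concave_on_inner_pair[OF assms(1)]) (use assms in auto)
  then have "(u\<^sup>2 * v\<^sup>2) * (fZ f (v + c02 f - \<beta> - l2) * fZ f (u + c02 f - \<beta> - l1))
      \<le> (u\<^sup>2 * v\<^sup>2) * (fZ f (u + c02 f - \<beta> - l2) * fZ f (v + c02 f - \<beta> - l1))"
    by (intro mult_left_mono) auto
  then show ?thesis by (simp add: weight_def mult_ac)
qed

lemma weight_log_convex:
  assumes "log_convex_on {..<c02 f - \<beta>} (fZ f)" "0 \<le> l1" "l1 \<le> l2" "v \<le> u" "u < 0"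
  shows "weight l2 u * weight l1 v \<le> weight l2 v * weight l1 u"
proof -
  have "fZ f (u + c02 f - \<beta> - l2) * fZ f (v + c02 f - \<beta> - l1)
      \<le> fZ f (v + c02 f - \<beta> - l2) * fZ f (u + c02 f - \<beta> - l1)"
    by (rule log_convex_on_inner_pair[OF assms(1)]) (use assms in auto)
  then have "(u\<^sup>2 * v\<^sup>2) * (fZ f (u + c02 f - \<beta> - l2) * fZ f (v + c02 f - \<beta> - l1))
      \<le> (u\<^sup>2 * v\<^sup>2) * (fZ f (v + c02 f - \<beta> - l2) * fZ f (u + c02 f - \<beta> - l1))"
    by (intro mult_left_mono) auto
  then show ?thesis by (simp add: weight_def mult_ac)
qed

text \<open>A larger \<lambda> lowers the argument of \<open>psi2\<close>, and dividing by the
  negative \<open>u\<close> turns this into growth of \<open>k2\<close> in \<lambda>. In both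
  alternatives \<open>k2\<close> and the likelihood ratio of the weights vary in the same direction
  in \<open>u\<close>.\<close>

lemma alpha2_mono:
  assumes "mono_on {..<c02 f - \<beta>} (psi2 f)"
    and "(log_concave_on {..<c02 f - \<beta>} (fZ f) \<and> (\<forall>l\<ge>0. mono_on {..<0} (\<lambda>z. k2 f \<beta> z l))) \<or>
       (log_convex_on {..<c02 f - \<beta>} (fZ f) \<and> (\<forall>l\<ge>0. antimono_on {..<0} (\<lambda>z. k2 f \<beta> z l)))"
  shows "mono_on {0..} (alpha2 f \<beta>)"
proof (rule mono_onI)
  fix l1 l2 :: real assume l: "l1 \<in> {0..}" "l2 \<in> {0..}" "l1 \<le> l2"
  have "1 * alpha2 f \<beta> l1 \<le> 1 * alpha2 f \<beta> l2"
  proof (rule alpha2_le)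
    fix u :: real assume "u < 0"
    with l have "psi2 f (u + c02 f - \<beta> - l2) \<le> psi2 f (u + c02 f - \<beta> - l1)"
      by (intro mono_onD[OF assms(1)]) auto
    with \<open>u < 0\<close> show "1 * k2 f \<beta> u l1 \<le> 1 * k2 f \<beta> u l2"
      by (simp add: k2_def divide_right_mono_neg)
  next
    fix u v :: real assume uv: "v \<le> u" "u < 0"
    show "(weight l2 v * weight l1 u \<le> weight l2 u * weight l1 v \<and> 1 * k2 f \<beta> v l2 \<le> 1 * k2 f \<beta> u l2) \<or>
          (weight l2 u * weight l1 v \<le> weight l2 v * weight l1 u \<and> 1 * k2 f \<beta> u l2 \<le> 1 * k2 f \<beta> v l2)"
      using assms(2) l uv weight_log_concave[OF _ _ l(3) uv] weight_log_convex[OF _ _ l(3) uv]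
      by (auto simp: monotone_on_def)
  qed (use l in auto)
  then show "alpha2 f \<beta> l1 \<le> alpha2 f \<beta> l2" by simp
qed

text \<open>With the sign -1 it is \<open>- k2\<close> that grows in \<lambda> and varies in
  \<open>u\<close> in the same direction as the likelihood ratio.\<close>

lemma alpha2_antimono:
  assumes "antimono_on {..<c02 f - \<beta>} (psi2 f)"
    and "(log_concave_on {..<c02 f - \<beta>} (fZ f) \<and> (\<forall>l\<ge>0. antimono_on {..<0} (\<lambda>z. k2 f \<beta> z l))) \<or>
       (log_convex_on {..<c02 f - \<beta>} (fZ f) \<and> (\<forall>l\<ge>0. mono_on {..<0} (\<lambda>z. k2 f \<beta> z l)))"
  shows "antimono_on {0..} (alpha2 f \<beta>)"
proof (rule monotone_onI)
  fix l1 l2 :: real assume l: "l1 \<in> {0..}" "l2 \<in> {0..}" "l1 \<le> l2"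
  have "-1 * alpha2 f \<beta> l1 \<le> -1 * alpha2 f \<beta> l2"
  proof (rule alpha2_le)
    fix u :: real assume "u < 0"
    with l have "psi2 f (u + c02 f - \<beta> - l1) \<le> psi2 f (u + c02 f - \<beta> - l2)"
      by (intro monotone_onD[OF assms(1)]) auto
    with \<open>u < 0\<close> show "-1 * k2 f \<beta> u l1 \<le> -1 * k2 f \<beta> u l2"
      by (simp add: k2_def divide_right_mono_neg)
  next
    fix u v :: real assume uv: "v \<le> u" "u < 0"
    show "(weight l2 v * weight l1 u \<le> weight l2 u * weight l1 v \<and> -1 * k2 f \<beta> v l2 \<le> -1 * k2 f \<beta> u l2) \<or>
          (weight l2 u * weight l1 v \<le> weight l2 v * weight l1 u \<and> -1 * k2 f \<beta> u l2 \<le> -1 * k2 f \<beta> v l2)"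
      using assms(2) l uv weight_log_concave[OF _ _ l(3) uv] weight_log_convex[OF _ _ l(3) uv]
      by (auto simp: monotone_on_def)
  qed (use l in auto)
  then show "alpha2 f \<beta> l2 \<le> alpha2 f \<beta> l1" by simp
qed

section \<open>The endpoints of the range as the value at 0 and the limit\<close>

text \<open>Convergence to the supremum makes \<open>Lim\<close> denote a genuine limit, by
  uniqueness of limits; the infimum is attained at 0.\<close>

lemma alpha2_limit_mono:
  assumes "mono_on {0..} (alpha2 f \<beta>)"
  shows "((\<lambda>l. ereal (alpha2 f \<beta> l)) \<longlongrightarrow> alpha2_inf f \<beta>) at_top"
    and "alpha_inf = ereal (alpha2 f \<beta> 0)" and "alpha_sup = alpha2_inf f \<beta>"
proof -
  have lim: "((\<lambda>l. ereal (alpha2 f \<beta> l)) \<longlongrightarrow> alpha_sup) at_top"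
    by (rule tendsto_SUP_at_top) (use assms in \<open>auto simp: monotone_on_def\<close>)
  then show sup: "alpha_sup = alpha2_inf f \<beta>"
    unfolding alpha2_inf_def by (simp add: tendsto_Lim)
  show "((\<lambda>l. ereal (alpha2 f \<beta> l)) \<longlongrightarrow> alpha2_inf f \<beta>) at_top"
    using lim unfolding sup .
  show "alpha_inf = ereal (alpha2 f \<beta> 0)"
    using assms by (intro INF_eqI) (auto simp: monotone_on_def)
qed

lemma alpha2_limit_antimono:
  assumes "antimono_on {0..} (alpha2 f \<beta>)"
  shows "((\<lambda>l. ereal (alpha2 f \<beta> l)) \<longlongrightarrow> alpha2_inf f \<beta>) at_top"
    and "alpha_sup = ereal (alpha2 f \<beta> 0)" and "alpha_inf = alpha2_inf f \<beta>"
proof -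
  have lim: "((\<lambda>l. ereal (alpha2 f \<beta> l)) \<longlongrightarrow> alpha_inf) at_top"
    by (rule tendsto_INF_at_top) (use assms in \<open>auto simp: monotone_on_def\<close>)
  then show inf: "alpha_inf = alpha2_inf f \<beta>"
    unfolding alpha2_inf_def by (simp add: tendsto_Lim)
  show "((\<lambda>l. ereal (alpha2 f \<beta> l)) \<longlongrightarrow> alpha2_inf f \<beta>) at_top"
    using lim unfolding inf .
  show "alpha_sup = ereal (alpha2 f \<beta> 0)"
    using assms by (intro SUP_eqI) (auto simp: monotone_on_def)
qed

end

theorem theorem3p2p1:
  fixes f :: "real \<times> real \<Rightarrow> real" and \<beta> :: real
  assumes f_borel: "f \<in> borel_measurable borel"
    and f_nonneg: "\<And>x. 0 \<le> f x"
    and f_prob: "prob_space (noise_dist f)"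
    and moment1: "integrable (noise_dist f) (\<lambda>z. (fst z)\<^sup>2)"
    and moment2: "integrable (noise_dist f) (\<lambda>z. (snd z)\<^sup>2)"
    and fZ_finite: "\<And>z. z < c02 f - \<beta> \<Longrightarrow> integrable lborel (\<lambda>s. f (s, s + z))"
    and fZ_pos: "\<And>z. z < c02 f - \<beta> \<Longrightarrow> 0 < fZ f z"
    and psi2_finite: "\<And>z. z < c02 f - \<beta> \<Longrightarrow> integrable lborel (\<lambda>s. s * f (s - z, s))"
  shows
    "(mono_on {..<c02 f - \<beta>} (psi2 f) \<and>
      ((log_concave_on {..<c02 f - \<beta>} (fZ f) \<and> (\<forall>l\<ge>0. mono_on {..<0} (\<lambda>z. k2 f \<beta> z l))) \<or>
       (log_convex_on {..<c02 f - \<beta>} (fZ f) \<and> (\<forall>l\<ge>0. antimono_on {..<0} (\<lambda>z. k2 f \<beta> z l))))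
      \<longrightarrow>
      ((\<lambda>l. ereal (alpha2 f \<beta> l)) \<longlongrightarrow> alpha2_inf f \<beta>) at_top \<and>
      {\<delta>. admissible_in f (D2 f \<beta>) \<delta>} =
        {delta_est f \<beta> \<alpha> | \<alpha>. ereal (alpha2 f \<beta> 0) \<le> ereal \<alpha> \<and> ereal \<alpha> \<le> alpha2_inf f \<beta>} \<and>
      (\<forall>a b. (a < b \<and> b \<le> alpha2 f \<beta> 0) \<or> (alpha2_inf f \<beta> \<le> ereal b \<and> b < a)
         \<longrightarrow> dominates f (delta_est f \<beta> b) (delta_est f \<beta> a)))
     \<and>
     (antimono_on {..<c02 f - \<beta>} (psi2 f) \<and>
      ((log_concave_on {..<c02 f - \<beta>} (fZ f) \<and> (\<forall>l\<ge>0. antimono_on {..<0} (\<lambda>z. k2 f \<beta> z l))) \<or>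
       (log_convex_on {..<c02 f - \<beta>} (fZ f) \<and> (\<forall>l\<ge>0. mono_on {..<0} (\<lambda>z. k2 f \<beta> z l))))
      \<longrightarrow>
      ((\<lambda>l. ereal (alpha2 f \<beta> l)) \<longlongrightarrow> alpha2_inf f \<beta>) at_top \<and>
      {\<delta>. admissible_in f (D2 f \<beta>) \<delta>} =
        {delta_est f \<beta> \<alpha> | \<alpha>. alpha2_inf f \<beta> \<le> ereal \<alpha> \<and> ereal \<alpha> \<le> ereal (alpha2 f \<beta> 0)} \<and>
      (\<forall>a b. (a < b \<and> ereal b \<le> alpha2_inf f \<beta>) \<or> (alpha2 f \<beta> 0 \<le> b \<and> b < a)
         \<longrightarrow> dominates f (delta_est f \<beta> b) (delta_est f \<beta> a)))"
proof -
  interpret location_model f \<beta>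
    by (rule location_model.intro) (fact assms)+
  show ?thesis (is "(?A \<longrightarrow> ?B) \<and> (?C \<longrightarrow> ?D)")
  proof (rule conjI; rule impI)
    assume ?A
    then have "mono_on {0..} (alpha2 f \<beta>)" by (intro alpha2_mono) auto
    note lim = alpha2_limit_mono[OF this]
    show ?B
      \<comment> \<open>Rewriting with \<open>lim(2,3)\<close> replaces infimum and supremum in the
        general results by the value at 0 and the limit.\<close>
      by (intro conjI allI impI lim(1) admissible_set[unfolded lim(2,3)]
          dominates_toward_range[unfolded lim(2,3)]) auto
  next
    assume ?C
    then have "antimono_on {0..} (alpha2 f \<beta>)" by (intro alpha2_antimono) auto
    note lim = alpha2_limit_antimono[OF this]
    show ?D
      by (intro conjI allI impI lim(1) admissible_set[unfolded lim(2,3)]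
          dominates_toward_range[unfolded lim(2,3)]) auto
  qed
qed

end
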